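(* Let $r\ge 35$ and $t\ge 1$ be integers and let $H$ be a graph from $\mathcal{H}_{r,t}$ on $n$ vertices. Let $G=(V,E)$ be the graph on $n$ vertices with $V=A_1\dot\cup A_2\dot\cup\cdots\dot\cup A_{100}$, $|A_i|=\frac{n}{100}$ for every $1\le i\le 100$, whose edges are exactly the following: $G[A_i,A_{i+1}]$ is a complete bipartite graph for every $1\le i\le 99$, and $G[A_1]$ and $G[A_{100}]$ are complete graphs on $n/100$ vertices. If $t\le 13$, then $H\not\subset G$, i.e. $G$ has no subgraph isomorphic to $H$.
   Context: All graphs are finite and simple. $\Delta$ denotes maximum degree, $|H|$ the number of vertices. For disjoint $X,Y\subset V(H)$, $H[X]$ is the induced subgraph on $X$ and $H[X,Y]$ is the bipartite subgraph of all edges of $H$ with one endpoint in $X$ and the other in $Y$ (similarly for $G$). An $r$-regular (non-bipartite) graph $U$ is a Ramanujan graph if $\lambda\le 2\sqrt{r-1}$, where $\lambda$ is the second largest in absolute value of the eigenvalues (with multiplicity) of the adjacency matrix of $U$, the largest being $r$. The bipartite graphs $F_i$: given an $r$-regular Ramanujan graph $U$ on $k$ vertices, $r\ge 35$, let $F$ be the $(r+1)$-regular bipartite graph with vertex classes $V_1=\{x_1:x\in V(U)\}$ and $V_2=\{x_2:x\in V(U)\}$ (two disjoint copies of $V(U)$), whose edges are $x_1y_2$ and $x_2y_1$ for every $xy\in E(U)$, and $x_1x_2$ for every $x\in V(U)$. Fix an infinite sequence of $r$-regular Ramanujan graphs on $k_1<k_2<\cdots$ vertices and let $F_i$ be the resulting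 bipartite graph on $2k_i$ vertices. The class $\mathcal{H}_{r,t}$ (for integers $r\ge 35$, $t\ge1$, with $\gamma=1/(8r2^r)$): given a sufficiently large $n$, let $i$ be such that $k_i$ is the largest with $2k_i\le\gamma n$. The $n$-vertex elements of $\mathcal{H}_{r,t}$ are the bipartite graphs $H=(A,B;E)$ such that: (1) $V(H)=A\cup B$ (disjoint vertex classes) and $|H|=n$; (2) there is $S\subset V(H)$, $S=S_A\,\dot\cup\,S_B$, with $|S_A|=|S_B|=k_i$; (3) $H[S_A]$ and $H[S_B]$ have no edges, and $H[S_A,S_B]=F_i$ (up to isomorphism, with $S_A,S_B$ playing the roles of the two vertex classes); (4) $D:=\Delta(H)=O(r2^r)$, with a fixed absolute implied constant; (5) $H-S$ has exactly $|S|$ components, all isomorphic; each component is a tree consisting of a path on $t$ vertices one of whose endpoints, the last vertex, has $D-1$ leaves attached to it; the other endpoint of the path is called the first vertex (if $t=1$, the first and last vertices coincide); (6) every $x\in S$ has a unique neighbor in $V(H)-S$, which is the first vertex of one of the tree components of $H-S$, and every first vertex has exactly one neighbor in $S$. *)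

theory Defs
  imports
    "Jordan_Normal_Form.Char_Poly"
    "HOL-Library.Multiset"
    "HOL-Library.Disjoint_Sets"
begin

section \<open>Finite simple graphs\<close>

datatype 'a graph = Graph (verts: "'a set") (edges: "'a set set")

definition simple_graph :: "'a graph \<Rightarrow> bool" where
  "simple_graph G \<longleftrightarrow> finite (verts G) \<and>
     (\<forall>e\<in>edges G. \<exists>u\<in>verts G. \<exists>v\<in>verts G. u \<noteq> v \<and> e = {u, v})"

definition vertex_degree :: "'a graph \<Rightarrow> 'a \<Rightarrow> nat" where
  "vertex_degree G v = card {w \<in> verts G. {v, w} \<in> edges G}"

definition max_degree :: "'a graph \<Rightarrow> nat" where
  "max_degree G = Max (vertex_degree G ` verts G)"

definition regular_graph :: "nat \<Rightarrow> 'a graph \<Rightarrow> bool" where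
  "regular_graph r G \<longleftrightarrow> (\<forall>v\<in>verts G. vertex_degree G v = r)"

definition bipartition :: "'a graph \<Rightarrow> 'a set \<Rightarrow> 'a set \<Rightarrow> bool" where
  "bipartition G A B \<longleftrightarrow> A \<inter> B = {} \<and> verts G = A \<union> B \<and>
     (\<forall>e\<in>edges G. \<exists>a\<in>A. \<exists>b\<in>B. e = {a, b})"

definition bipartite :: "'a graph \<Rightarrow> bool" where
  "bipartite G \<longleftrightarrow> (\<exists>A B. bipartition G A B)"

definition induced :: "'a graph \<Rightarrow> 'a set \<Rightarrow> 'a graph" where
  "induced G X = Graph X {e \<in> edges G. e \<subseteq> X}"

definition induced_between :: "'a graph \<Rightarrow> 'a set \<Rightarrow> 'a set \<Rightarrow> 'a graph" where
  "induced_between G X Y =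
     Graph (X \<union> Y) {e \<in> edges G. \<exists>x\<in>X. \<exists>y\<in>Y. e = {x, y}}"

definition subgraph :: "'a graph \<Rightarrow> 'a graph \<Rightarrow> bool" where
  "subgraph K G \<longleftrightarrow> simple_graph K \<and> verts K \<subseteq> verts G \<and> edges K \<subseteq> edges G"

definition graph_iso :: "('a \<Rightarrow> 'b) \<Rightarrow> 'a graph \<Rightarrow> 'b graph \<Rightarrow> bool" where
  "graph_iso f G H \<longleftrightarrow> bij_betw f (verts G) (verts H) \<and>
     (\<forall>u\<in>verts G. \<forall>v\<in>verts G. {u, v} \<in> edges G \<longleftrightarrow> {f u, f v} \<in> edges H)"

definition isomorphic :: "'a graph \<Rightarrow> 'b graph \<Rightarrow> bool" where
  "isomorphic G H \<longleftrightarrow> (\<exists>f. graph_iso f G H)"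

definition graph_components :: "'a graph \<Rightarrow> 'a graph set" where
  "graph_components G =
     (\<lambda>v. induced G {w \<in> verts G. (\<lambda>x y. {x, y} \<in> edges G)\<^sup>*\<^sup>* v w}) ` verts G"


section \<open>Ramanujan graphs\<close>

text \<open>
  The rows and columns of the adjacency matrix are indexed by an arbitrary enumeration of the
  (finite) vertex set; its characteristic polynomial does not depend on the enumeration.
\<close>

definition vertex_list :: "'a graph \<Rightarrow> 'a list" where
  "vertex_list G = (SOME xs. distinct xs \<and> set xs = verts G)"

definition adjacency_matrix :: "'a graph \<Rightarrow> real mat" where
  "adjacency_matrix G =
     mat (card (verts G)) (card (verts G))
       (\<lambda>(i, j). if {vertex_list G ! i, vertex_list G ! j} \<in> edges G then 1 else 0)"

text \<open>
  Eigenvalues are counted with algebraic multiplicity. The matrix is real and symmetric, so all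
  complex roots of its characteristic polynomial are real and none is missed.
\<close>

definition eigenvalue_mset :: "'a graph \<Rightarrow> real multiset" where
  "eigenvalue_mset G = proots (char_poly (adjacency_matrix G))"

text \<open>
  Index 1 of the list of absolute values in decreasing order; meaningful for graphs with at
  least two vertices.
\<close>

definition second_abs_eigenvalue :: "'a graph \<Rightarrow> real" where
  "second_abs_eigenvalue G =
     rev (sorted_list_of_multiset (image_mset abs (eigenvalue_mset G))) ! 1"

definition ramanujan :: "nat \<Rightarrow> 'a graph \<Rightarrow> bool" where
  "ramanujan r G \<longleftrightarrow> simple_graph G \<and> regular_graph r G \<and> \<not> bipartite G \<and>
     second_abs_eigenvalue G \<le> 2 * sqrt (real r - 1)"

definition ramanujan_sequence :: "nat \<Rightarrow> (nat \<Rightarrow> 'u graph) \<Rightarrow> bool" where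
  "ramanujan_sequence r U \<longleftrightarrow>
     (\<forall>i. ramanujan r (U i)) \<and> strict_mono (\<lambda>i. card (verts (U i)))"


section \<open>The class of graphs H\<close>

text \<open>The vertex classes are the two summands, \<open>Inl ` verts U\<close> and \<open>Inr ` verts U\<close>.\<close>

definition double_cover_plus :: "'u graph \<Rightarrow> ('u + 'u) graph" where
  "double_cover_plus U =
     Graph (verts U <+> verts U)
       ({{Inl x, Inr y} | x y. x \<in> verts U \<and> y \<in> verts U \<and> {x, y} \<in> edges U}
        \<union> {{Inl x, Inr x} | x. x \<in> verts U})"

text \<open>
  The path is \<open>0, \<dots>, t - 1\<close>, with first vertex \<open>0\<close> and last vertex \<open>t - 1\<close>; the leaves
  attached to the last vertex are \<open>t, \<dots>, t + d - 1\<close>.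
\<close>

definition broom :: "nat \<Rightarrow> nat \<Rightarrow> nat graph" where
  "broom t d =
     Graph {0..<t + d}
       ({{j, Suc j} | j. Suc j < t} \<union> {{t - 1, l} | l. t \<le> l \<and> l < t + d})"

definition gamma_r :: "nat \<Rightarrow> real" where
  "gamma_r r = 1 / (8 * real r * 2 ^ r)"

text \<open>
  \<open>U\<close> is the fixed sequence of Ramanujan graphs and \<open>C\<close> the fixed constant implied in the bound
  \<open>O(r2\<^sup>r)\<close> on the maximum degree. The order \<open>n\<close> is sufficiently large when the
  index \<open>i\<close> exists. The function \<open>lab\<close> chooses an isomorphism from the broom to every component
  and so fixes the first vertex \<open>lab K 0\<close> of each component \<open>K\<close>.
\<close>

definition H_class :: "real \<Rightarrow> (nat \<Rightarrow> 'u graph) \<Rightarrow> nat \<Rightarrow> nat \<Rightarrow> nat \<Rightarrow> 'a graph set" where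
  "H_class C U r t n = {H.
     simple_graph H \<and> card (verts H) = n \<and> bipartite H \<and>
     real (max_degree H) \<le> C * (real r * 2 ^ r) \<and>
     (\<exists>i S SA SB lab.
        2 * real (card (verts (U i))) \<le> gamma_r r * real n \<and>
        (\<forall>j. 2 * real (card (verts (U j))) \<le> gamma_r r * real n
              \<longrightarrow> card (verts (U j)) \<le> card (verts (U i))) \<and>
        S \<subseteq> verts H \<and> S = SA \<union> SB \<and> SA \<inter> SB = {} \<and>
        card SA = card (verts (U i)) \<and> card SB = card (verts (U i)) \<and>
        edges (induced H SA) = {} \<and> edges (induced H SB) = {} \<and>
        (\<exists>f. graph_iso f (double_cover_plus (U i)) (induced_between H SA SB) \<and>
             f ` Inl ` verts (U i) = SA \<and> f ` Inr ` verts (U i) = SB) \<and>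
        (let D = max_degree H;
             comps = graph_components (induced H (verts H - S));
             firsts = (\<lambda>K. lab K (0::nat)) ` comps
         in card comps = card S \<and>
            (\<forall>K\<in>comps. \<forall>L\<in>comps. isomorphic K L) \<and>
            (\<forall>K\<in>comps. graph_iso (lab K) (broom t (D - 1)) K) \<and>
            (\<forall>x\<in>S. \<exists>!y. y \<in> verts H - S \<and> {x, y} \<in> edges H) \<and>
            (\<forall>x\<in>S. \<forall>y\<in>verts H - S. {x, y} \<in> edges H \<longrightarrow> y \<in> firsts) \<and>
            (\<forall>y\<in>firsts. \<exists>!x. x \<in> S \<and> {x, y} \<in> edges H)))}"


section \<open>The host graph G\<close>

text \<open>A chain of 100 classes, consecutive ones completely joined, the two end classes cliques.\<close>

definition chain_graph :: "(nat \<Rightarrow> 'b set) \<Rightarrow> 'b graph" where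
  "chain_graph A =
     Graph (\<Union>i\<in>{1..100}. A i)
       ({{u, v} | u v. \<exists>i\<in>{1..99}. u \<in> A i \<and> v \<in> A (i + 1)}
        \<union> {{u, v} | u v. u \<in> A 1 \<and> v \<in> A 1 \<and> u \<noteq> v}
        \<union> {{u, v} | u v. u \<in> A 100 \<and> v \<in> A 100 \<and> u \<noteq> v})"

end

theory Submission
  imports Defs "HOL-Analysis.Function_Topology"
begin

text \<open>
  An embedding of \<open>H\<close> into the chain \<open>G\<close> is spanning, since both graphs have \<open>n\<close> vertices.
  Recording the class \<open>A i\<close> that contains the image of a vertex therefore distributes
  \<open>V(H)\<close> over 100 levels of equal size, and the two ends of an edge of \<open>H\<close> lie on equal or
  neighbouring levels (\<open>chain_graph_layering\<close>). The contradiction is that \<open>H\<close> can reach both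
  ends of the chain only by stretching the expander on \<open>S\<close>.

  Every vertex of \<open>S\<close> owns itself and the broom hanging from it. The owned sets partition
  \<open>V(H)\<close> into \<open>|S|\<close> parts of equal size, and every vertex is within distance
  \<open>t + 1 \<le> 14\<close> of its owner (\<open>broom_ownership\<close>). Level 1 contains one percent of all
  vertices, so at least one percent of \<open>S\<close> lies on the levels up to 15; for the same reason
  at least one percent of \<open>S\<close> lies on the levels from 86 on.

  Let \<open>g\<close> be the level of the first copy of a vertex of the Ramanujan graph \<open>U\<close>. As the two
  copies of a vertex are adjacent, \<open>g\<close> changes by at most 2 along an edge of \<open>U\<close>, at least one
  percent of \<open>V(U)\<close> has \<open>g \<le> 16\<close>, and at least one percent has \<open>g \<ge> 85\<close>. The spectral gap
  makes this impossible (\<open>ramanujan_lipschitz_levels\<close>): a function on \<open>U\<close> that changes by at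
  most 2 along edges has variance at most 4, whereas two such parts, 69 apart, force a variance of
  at least \<open>69\<^sup>2 / 200\<close>, which exceeds 23.

  The spectral gap is given through the roots of the characteristic polynomial, but is used
  through the quadratic form of the adjacency matrix. The bridge is a maximiser \<open>f\<close> of the
  Rayleigh quotient among the functions with sum 0, which exists by compactness and is an
  eigenvector for its maximum \<open>\<mu>\<close> (\<open>rayleigh_maximiser\<close>). Together with the constant vector, which
  belongs to the eigenvalue \<open>r\<close>, it yields the factor \<open>(X - r)(X - \<mu>)\<close> of the characteristic
  polynomial (\<open>two_eigenvectors_dvd_char_poly\<close>), even if \<open>\<mu> = r\<close>. So the second largest absolute
  value of an eigenvalue is at least \<open>min r \<bar>\<mu>\<bar>\<close>; it is at most \<open>2 sqrt (r - 1) \<le> r / 2\<close>,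
  and hence \<open>\<mu> \<le> r / 2\<close>.
\<close>

section \<open>Maximising the Rayleigh quotient orthogonally to the constants\<close>

text \<open>
  The maximum over the unit sphere of the functions with sum 0 is attained by compactness. Because
  all row sums agree, the matrix maps functions with sum 0 to functions with sum 0, so the defect
  \<open>w = \<mu> f - a f\<close> is an admissible direction; the first variation of the Rayleigh quotient in that
  direction is the squared norm of \<open>w\<close>, which must vanish at a maximum.
\<close>

lemma rayleigh_maximiser:
  fixes a :: "'a \<Rightarrow> 'a \<Rightarrow> real"
  assumes fin: "finite V" and two: "u0 \<in> V" "v0 \<in> V" "u0 \<noteq> v0"
    and sym: "\<And>x y. a x y = a y x"
    and rows: "\<And>x. x \<in> V \<Longrightarrow> (\<Sum>y\<in>V. a x y) = r"
  obtains f \<mu> where "(\<Sum>x\<in>V. f x) = 0" "(\<Sum>x\<in>V. (f x)\<^sup>2) = 1"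
    "\<And>x. x \<in> V \<Longrightarrow> (\<Sum>y\<in>V. a x y * f y) = \<mu> * f x"
    "\<And>g. (\<Sum>x\<in>V. g x) = 0 \<Longrightarrow>
       (\<Sum>x\<in>V. \<Sum>y\<in>V. a x y * g x * g y) \<le> \<mu> * (\<Sum>x\<in>V. (g x)\<^sup>2)"
proof -
  define Q where "Q g = (\<Sum>x\<in>V. \<Sum>y\<in>V. a x y * g x * g y)" for g :: "'a \<Rightarrow> real"
  (* Outside V the functions are pinned to 0, which makes K a closed subset of a product of
     compact sets. *)
  define B where "B x = (if x \<in> V then {-1..1} else {0::real})" for x
  define K where "K = PiE UNIV B \<inter> {f. (\<Sum>x\<in>V. f x) = 0} \<inter> {f. (\<Sum>x\<in>V. (f x)\<^sup>2) = 1}"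
  have coord: "continuous_on UNIV (\<lambda>f::'a \<Rightarrow> real. f x)" for x
    by (rule continuous_on_product_coordinates)
  have "compact (PiE UNIV B)"
  proof -
    have "compactin (product_topology (\<lambda>_. euclidean) UNIV) (PiE UNIV B)"
      unfolding compactin_PiE by (auto simp: B_def)
    then show ?thesis
      by (simp add: euclidean_product_topology)
  qed
  moreover have "closed {f::'a \<Rightarrow> real. (\<Sum>x\<in>V. f x) = 0}"
    by (intro closed_Collect_eq continuous_intros coord)
  moreover have "closed {f::'a \<Rightarrow> real. (\<Sum>x\<in>V. (f x)\<^sup>2) = 1}"
    by (intro closed_Collect_eq continuous_intros coord)
  ultimately have "compact K"
    unfolding K_def by (intro compact_Int_closed)
  have K_memI: "h \<in> K" if "\<And>x. x \<notin> V \<Longrightarrow> h x = 0" "(\<Sum>x\<in>V. h x) = 0" "(\<Sum>x\<in>V. (h x)\<^sup>2) = 1" for h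
  proof -
    have "h x \<in> B x" for x
    proof (cases "x \<in> V")
      case True
      have "(h x)\<^sup>2 \<le> (\<Sum>x\<in>V. (h x)\<^sup>2)"
        by (rule member_le_sum) (use True fin in auto)
      then have "\<bar>h x\<bar> \<le> 1"
        using that(3) by (simp add: abs_square_le_1)
      then show ?thesis using True by (auto simp: B_def)
    qed (use that in \<open>auto simp: B_def\<close>)
    then show ?thesis
      using that unfolding K_def by auto
  qed
  (* K is nonempty: a normalised difference of two point masses. *)
  define e where "e x = (if x = u0 then 1 / sqrt 2 else if x = v0 then - 1 / sqrt 2 else 0)" for x
  have V_split: "V = insert u0 (insert v0 (V - {u0, v0}))"
    using two by auto
  have e0: "(\<Sum>x\<in>V - {u0, v0}. e x) = 0" "(\<Sum>x\<in>V - {u0, v0}. (e x)\<^sup>2) = 0"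
    by (auto simp: e_def intro!: sum.neutral)
  have "(\<Sum>x\<in>V. e x) = 0"
    by (subst V_split) (use two fin e0 in \<open>simp add: e_def\<close>)
  moreover have "(\<Sum>x\<in>V. (e x)\<^sup>2) = 1"
    by (subst V_split) (use two fin e0 in \<open>simp add: e_def power_divide\<close>)
  ultimately have "e \<in> K"
    using two by (intro K_memI) (auto simp: e_def)
  have "continuous_on K Q"
    unfolding Q_def
    by (intro continuous_intros continuous_on_subset[OF coord]) auto
  with \<open>compact K\<close> \<open>e \<in> K\<close> obtain f where f: "f \<in> K" and max: "\<And>h. h \<in> K \<Longrightarrow> Q h \<le> Q f"
    using continuous_attains_sup[of K Q] by auto
  define \<mu> where "\<mu> = Q f"
  have f0: "(\<Sum>x\<in>V. f x) = 0" and f1: "(\<Sum>x\<in>V. (f x)\<^sup>2) = 1"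
    using f by (auto simp: K_def)
  have bound: "Q g \<le> \<mu> * (\<Sum>x\<in>V. (g x)\<^sup>2)" if g0: "(\<Sum>x\<in>V. g x) = 0" for g
  proof (cases "(\<Sum>x\<in>V. (g x)\<^sup>2) = 0")
    case True
    then have "\<And>x. x \<in> V \<Longrightarrow> g x = 0"
      using fin by (simp add: sum_nonneg_eq_0_iff)
    then show ?thesis using True by (simp add: Q_def)
  next
    case False
    define s where "s = (\<Sum>x\<in>V. (g x)\<^sup>2)"
    have s: "s > 0" using False unfolding s_def
      by (metis less_eq_real_def sum_nonneg zero_le_power2)
    define h where "h x = (if x \<in> V then g x / sqrt s else 0)" for x
    have "(\<Sum>x\<in>V. h x) = 0"
      using g0 by (simp add: h_def sum_divide_distrib[symmetric])
    moreover have "(\<Sum>x\<in>V. (h x)\<^sup>2) = 1"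
      using s by (simp add: h_def power_divide sum_divide_distrib[symmetric]) (simp add: s_def)
    ultimately have "h \<in> K" by (intro K_memI) (auto simp: h_def)
    then have "Q h \<le> \<mu>" using max \<mu>_def by simp
    moreover have "Q h = (\<Sum>x\<in>V. \<Sum>y\<in>V. a x y * g x * g y / s)"
      unfolding Q_def using s by (intro sum.cong refl) (simp add: h_def field_simps)
    then have "Q h = Q g / s"
      unfolding Q_def by (simp add: sum_divide_distrib)
    ultimately show ?thesis
      using s by (simp add: s_def[symmetric] field_simps)
  qed
  define Af where "Af x = (\<Sum>y\<in>V. a x y * f y)" for x
  define w where "w x = \<mu> * f x - Af x" for x
  have "(\<Sum>x\<in>V. Af x) = (\<Sum>y\<in>V. (\<Sum>x\<in>V. a y x) * f y)"
    unfolding Af_def by (subst sum.swap) (simp add: sum_distrib_right sym)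
  also have "\<dots> = r * (\<Sum>y\<in>V. f y)"
    by (simp add: rows sum_distrib_left)
  finally have "(\<Sum>x\<in>V. Af x) = 0" using f0 by simp
  then have w0: "(\<Sum>x\<in>V. w x) = 0"
    using f0 by (simp add: w_def sum_subtractf sum_distrib_left[symmetric])
  define W where "W = (\<Sum>x\<in>V. (w x)\<^sup>2)"
  define c where "c = \<mu> * W - Q w"
  have c0: "c \<ge> 0" using bound[OF w0] by (simp add: c_def W_def)
  have W_alt: "W = \<mu> * (\<Sum>x\<in>V. f x * w x) - (\<Sum>x\<in>V. Af x * w x)"
  proof -
    have "W = (\<Sum>x\<in>V. \<mu> * (f x * w x) - Af x * w x)"
      unfolding W_def by (intro sum.cong refl) (simp add: w_def power2_eq_square algebra_simps)
    then show ?thesis by (simp add: sum_subtractf sum_distrib_left)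
  qed
  have quad: "0 \<le> 2 * s * W + s\<^sup>2 * c" for s
  proof -
    have cross1: "(\<Sum>x\<in>V. \<Sum>y\<in>V. a x y * w x * f y) = (\<Sum>x\<in>V. Af x * w x)"
      by (simp add: Af_def sum_distrib_right sum_distrib_left algebra_simps)
    have cross2: "(\<Sum>x\<in>V. \<Sum>y\<in>V. a x y * f x * w y) = (\<Sum>x\<in>V. Af x * w x)"
      by (subst sum.swap) (simp add: Af_def sum_distrib_right sum_distrib_left sym algebra_simps)
    have "Q (\<lambda>x. f x + s * w x) = (\<Sum>x\<in>V. \<Sum>y\<in>V. a x y * f x * f y + s * (a x y * w x * f y)
         + s * (a x y * f x * w y) + s\<^sup>2 * (a x y * w x * w y))"
      unfolding Q_def by (intro sum.cong refl) (simp add: algebra_simps power2_eq_square)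
    also have "\<dots> = \<mu> + 2 * s * (\<Sum>x\<in>V. Af x * w x) + s\<^sup>2 * Q w"
      by (simp add: sum.distrib sum_distrib_left[symmetric] cross1 cross2 \<mu>_def Q_def)
    finally have Qs: "Q (\<lambda>x. f x + s * w x) = \<mu> + 2 * s * (\<Sum>x\<in>V. Af x * w x) + s\<^sup>2 * Q w" .
    have "(\<Sum>x\<in>V. (f x + s * w x)\<^sup>2) = (\<Sum>x\<in>V. (f x)\<^sup>2 + 2 * s * (f x * w x) + s\<^sup>2 * (w x)\<^sup>2)"
      by (intro sum.cong refl) (simp add: algebra_simps power2_eq_square)
    also have "\<dots> = 1 + 2 * s * (\<Sum>x\<in>V. f x * w x) + s\<^sup>2 * W"
      by (simp add: sum.distrib sum_distrib_left[symmetric] f1 W_def)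
    finally have Ns: "(\<Sum>x\<in>V. (f x + s * w x)\<^sup>2) = 1 + 2 * s * (\<Sum>x\<in>V. f x * w x) + s\<^sup>2 * W" .
    have "(\<Sum>x\<in>V. f x + s * w x) = 0"
      using f0 w0 by (simp add: sum.distrib sum_distrib_left[symmetric])
    from bound[OF this] show ?thesis
      unfolding Qs Ns by (simp add: W_alt c_def algebra_simps)
  qed
  have "W = 0"
  proof (rule ccontr)
    assume "W \<noteq> 0"
    then have "W\<^sup>2 > 0" by simp
    (* The linear term of quad dominates for small negative s; this s is small enough for every
       c \<ge> 0. *)
    have "2 * (- W / (c + 1)) * W + (- W / (c + 1))\<^sup>2 * c = - W\<^sup>2 * (c + 2) / (c + 1)\<^sup>2"
      using c0 by (simp add: power2_eq_square add_nonneg_eq_0_iff divide_simps) (simp add: algebra_simps)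
    also have "\<dots> < 0"
      using c0 \<open>W\<^sup>2 > 0\<close> by (simp add: divide_less_0_iff mult_less_0_iff)
    finally show False using quad[of "- W / (c + 1)"] by simp
  qed
  then have "\<And>x. x \<in> V \<Longrightarrow> w x = 0"
    using fin by (simp add: W_def sum_nonneg_eq_0_iff)
  then have "\<And>x. x \<in> V \<Longrightarrow> (\<Sum>y\<in>V. a x y * f y) = \<mu> * f x"
    by (simp add: w_def Af_def)
  with f0 f1 bound show thesis
    using that unfolding Q_def by blast
qed

section \<open>Eigenvectors and the roots of the characteristic polynomial\<close>

text \<open>
  Replacing two columns of the identity matrix by the eigenvectors gives a matrix \<open>P\<close> whose
  determinant is, up to sign, the minor of the eigenvectors in the rows \<open>i\<close> and \<open>j\<close>. In
  \<open>(X - M) P\<close> the two replaced columns are multiples of \<open>X - \<alpha>\<close> and \<open>X - \<beta>\<close>, and taking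
  determinants gives the divisibility. As independence enters through the minor only, the case
  \<open>\<alpha> = \<beta>\<close> of a double root is covered.
\<close>

lemma two_eigenvectors_dvd_char_poly:
  fixes M :: "'a::field mat"
  assumes M: "M \<in> carrier_mat n n"
    and ij: "i < n" "j < n"
    and u: "\<And>a. a < n \<Longrightarrow> (\<Sum>b<n. M $$ (a, b) * u b) = \<alpha> * u a"
    and v: "\<And>a. a < n \<Longrightarrow> (\<Sum>b<n. M $$ (a, b) * v b) = \<beta> * v a"
    and minor: "u i * v j \<noteq> u j * v i"
  shows "[:- \<alpha>, 1:] * [:- \<beta>, 1:] dvd char_poly M"
proof -
  have "i \<noteq> j" using minor by auto
  define p where "p a c = (if c = i then u a else if c = j then v a else if a = c then 1 else 0)" for a c
  define P where "P = mat n n (\<lambda>(a, c). p a c)"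
  have P: "P \<in> carrier_mat n n" by (simp add: P_def)
  have detP: "det P \<noteq> 0"
  proof
    assume "det P = 0"
    then obtain w where w: "w \<in> carrier_vec n" "w \<noteq> 0\<^sub>v n" "P *\<^sub>v w = 0\<^sub>v n"
      using det_0_iff_vec_prod_zero_field[OF P] by auto
    have row: "u a * w $ i + v a * w $ j + (if a = i \<or> a = j then 0 else w $ a) = 0" if "a < n" for a
    proof -
      have "0 = (P *\<^sub>v w) $ a" using w that by simp
      also have "\<dots> = (\<Sum>c<n. p a c * w $ c)"
        using that w(1) by (simp add: P_def scalar_prod_def atLeast0LessThan)
      also have "\<dots> = (\<Sum>c<n. (if c = i then u a * w $ i else 0) + (if c = j then v a * w $ j else 0)
          + (if c = a then (if a = i \<or> a = j then 0 else w $ a) else 0))"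
        using \<open>i \<noteq> j\<close> by (intro sum.cong refl) (auto simp: p_def)
      also have "\<dots> = u a * w $ i + v a * w $ j + (if a = i \<or> a = j then 0 else w $ a)"
        using ij that by (simp add: sum.distrib)
      finally show ?thesis by simp
    qed
    have ri: "u i * w $ i + v i * w $ j = 0" and rj: "u j * w $ i + v j * w $ j = 0"
      using row[OF ij(1)] row[OF ij(2)] by simp_all
    have "(u i * v j - u j * v i) * w $ i
        = v j * (u i * w $ i + v i * w $ j) - v i * (u j * w $ i + v j * w $ j)"
      by (simp add: algebra_simps)
    then have wi: "w $ i = 0" using ri rj minor by simp
    have "(u i * v j - u j * v i) * w $ j
        = u i * (u j * w $ i + v j * w $ j) - u j * (u i * w $ i + v i * w $ j)"
      by (simp add: algebra_simps)
    then have wj: "w $ j = 0" using ri rj minor by simp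
    have "w $ a = 0" if "a < n" for a
      using row[OF that] wi wj by (auto split: if_splits)
    then have "w = 0\<^sub>v n" using w(1) by auto
    with w(2) show False by simp
  qed
  (* Both factors must live over the polynomial ring, so P is lifted to constant polynomials. *)
  interpret const: comm_ring_hom "\<lambda>a::'a. [:a:]"
    by unfold_locales (auto simp: one_pCons)
  define P' where "P' = map_mat (\<lambda>a. [:a:]) P"
  have P': "P' \<in> carrier_mat n n" using P by (simp add: P'_def)
  have detP': "det P' = [:det P:]"
    unfolding P'_def by (rule const.hom_det)
  define X where "X = char_poly_matrix M"
  have X: "X \<in> carrier_mat n n" using M by (simp add: X_def)
  have Xab: "X $$ (a, b) = (if a = b then [:0, 1:] else 0) - [:M $$ (a, b):]" if "a < n" "b < n" for a b
    using that M by (simp add: X_def char_poly_matrix_def)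
  (* Q carries the columns of the product after the linear factors have been split off into the
     diagonal matrix D. *)
  define d where "d c = (if c = i then [:- \<alpha>, 1:] else if c = j then [:- \<beta>, 1:] else 1)" for c
  define D where "D = mat n n (\<lambda>(b, c). if b = c then d c else 0)"
  have D: "D \<in> carrier_mat n n" by (simp add: D_def)
  define Q where "Q = mat n n (\<lambda>(a, c). if c = i then [:u a:] else if c = j then [:v a:] else X $$ (a, c))"
  have Q: "Q \<in> carrier_mat n n" by (simp add: Q_def)
  have eig: "(\<Sum>b<n. X $$ (a, b) * [:z b:]) = [:z a:] * [:- \<gamma>, 1:]"
    if "a < n" and z: "(\<Sum>b<n. M $$ (a, b) * z b) = \<gamma> * z a" for a z \<gamma>
  proof -
    have "(\<Sum>b<n. X $$ (a, b) * [:z b:]) = (\<Sum>b<n. (if b = a then [:0, 1:] * [:z a:] else 0) - [:M $$ (a, b) * z b:])"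
      using \<open>a < n\<close> by (intro sum.cong refl) (auto simp: Xab left_diff_distrib)
    also have "\<dots> = [:0, z a:] - (\<Sum>b<n. [:M $$ (a, b) * z b:])"
      using \<open>a < n\<close> by (simp add: sum_subtractf)
    also have "(\<Sum>b<n. [:M $$ (a, b) * z b:]) = [:\<gamma> * z a:]"
      by (simp add: const.hom_sum[symmetric] z)
    finally show ?thesis by (simp add: algebra_simps)
  qed
  have "X * P' = Q * D"
  proof (rule eq_matI)
    fix a c assume "a < dim_row (Q * D)" "c < dim_col (Q * D)"
    then have ac: "a < n" "c < n" using Q D by auto
    have "(X * P') $$ (a, c) = (\<Sum>b<n. X $$ (a, b) * [:p b c:])"
      using ac X P by (simp add: P'_def scalar_prod_def atLeast0LessThan P_def)
    also have "\<dots> = Q $$ (a, c) * d c"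
    proof (cases "c = i \<or> c = j")
      case True
      then show ?thesis
        using ac \<open>i \<noteq> j\<close> eig[OF ac(1) u[OF ac(1)]] eig[OF ac(1) v[OF ac(1)]]
        by (auto simp: p_def Q_def d_def)
    next
      case False
      then have "(\<Sum>b<n. X $$ (a, b) * [:p b c:]) = (\<Sum>b<n. if b = c then X $$ (a, c) else 0)"
        by (intro sum.cong refl) (auto simp: p_def)
      then show ?thesis using False ac by (simp add: Q_def d_def)
    qed
    also have "\<dots> = (\<Sum>b<n. if b = c then Q $$ (a, c) * d c else 0)"
      using ac by simp
    also have "\<dots> = (\<Sum>b<n. Q $$ (a, b) * D $$ (b, c))"
      using ac by (intro sum.cong refl) (auto simp: D_def)
    also have "\<dots> = (Q * D) $$ (a, c)"
      using ac Q D by (simp add: scalar_prod_def atLeast0LessThan)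
    finally show "(X * P') $$ (a, c) = (Q * D) $$ (a, c)" .
  qed (use X P' Q D in auto)
  then have "det X * det P' = det Q * det D"
    using det_mult[OF X P'] det_mult[OF Q D] by simp
  moreover have "det D = (\<Prod>c<n. d c)"
  proof -
    have "det D = prod_list (diag_mat D)"
      by (rule det_upper_triangular[OF _ D]) (auto simp: D_def upper_triangular_def)
    also have "diag_mat D = map d [0..<n]"
      by (auto simp: diag_mat_def D_def)
    finally show ?thesis
      by (simp add: prod.list_conv_set_nth atLeast0LessThan)
  qed
  moreover have "[:- \<alpha>, 1:] * [:- \<beta>, 1:] dvd (\<Prod>c<n. d c)"
  proof -
    have "(\<Prod>c\<in>{i, j}. d c) dvd (\<Prod>c<n. d c)"
      using ij by (intro prod_dvd_prod_subset) auto
    then show ?thesis using \<open>i \<noteq> j\<close> by (simp add: d_def)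
  qed
  ultimately have "[:- \<alpha>, 1:] * [:- \<beta>, 1:] dvd char_poly M * [:det P:]"
    unfolding char_poly_def X_def[symmetric] detP'[symmetric] by (metis dvd_mult)
  then show ?thesis
    using dvd_smult_iff[OF detP] by simp
qed

text \<open>
  Index 1 of the decreasing list is the second largest entry with multiplicity, so if it were below
  both members of the pair, at most one entry could reach their minimum.
\<close>

lemma second_largest_ge_of_pair:
  fixes a b :: real
  assumes "{#a, b#} \<subseteq># X"
  shows "rev (sorted_list_of_multiset X) ! 1 \<ge> min a b"
proof (rule ccontr)
  define L where "L = rev (sorted_list_of_multiset X)"
  assume "\<not> rev (sorted_list_of_multiset X) ! 1 \<ge> min a b"
  then have less: "L ! 1 < min a b" by (simp only: L_def not_le)
  have mL: "mset L = X" by (simp add: L_def)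
  have "size {#a, b#} \<le> size X" using assms by (rule size_mset_mono)
  then have len: "length L \<ge> 2" using mL size_mset by fastforce
  then obtain x y L' where L: "L = x # y # L'"
    by (metis One_nat_def Suc_1 Suc_le_length_iff)
  have "sorted (rev L)" by (simp add: L_def)
  then have "\<forall>z\<in>set L'. z \<le> y"
    unfolding L by (auto simp: sorted_append)
  then have tail: "filter_mset (\<lambda>z. z \<ge> min a b) (mset L') = {#}"
    using less by (fastforce simp: L)
  have "\<not> y \<ge> min a b" using less unfolding L by (simp add: min_le_iff_disj not_le)
  then have "filter_mset (\<lambda>z. z \<ge> min a b) X \<subseteq># {#x#}"
    unfolding mL[symmetric] L by (simp add: tail del: min.bounded_iff min_le_iff_disj)
  moreover have "filter_mset (\<lambda>z. z \<ge> min a b) {#a, b#} \<subseteq># filter_mset (\<lambda>z. z \<ge> min a b) X"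
    using assms by (rule multiset_filter_mono)
  ultimately have "size (filter_mset (\<lambda>z. z \<ge> min a b) {#a, b#}) \<le> size {#x#}"
    by (meson size_mset_mono subset_mset.order_trans)
  then show False by simp
qed

text \<open>
  The statement about eigenfunctions on the vertices makes no reference to the enumeration that
  indexes the adjacency matrix. The non-vanishing minor says that the two functions are linearly
  independent.
\<close>

lemma second_abs_eigenvalue_ge:
  fixes f g :: "'a \<Rightarrow> real"
  assumes fin: "finite (verts G)"
    and f: "\<And>x. x \<in> verts G \<Longrightarrow> (\<Sum>y | y \<in> verts G \<and> {x, y} \<in> edges G. f y) = \<alpha> * f x"
    and g: "\<And>x. x \<in> verts G \<Longrightarrow> (\<Sum>y | y \<in> verts G \<and> {x, y} \<in> edges G. g y) = \<beta> * g x"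
    and xy: "x \<in> verts G" "y \<in> verts G" "f x * g y \<noteq> f y * g x"
  shows "second_abs_eigenvalue G \<ge> min \<bar>\<alpha>\<bar> \<bar>\<beta>\<bar>"
proof -
  define xs where "xs = vertex_list G"
  define M where "M = adjacency_matrix G"
  define n where "n = card (verts G)"
  have "\<exists>xs. distinct xs \<and> set xs = verts G"
    using finite_distinct_list[OF fin] by blast
  then have xs: "distinct xs" "set xs = verts G"
    unfolding xs_def vertex_list_def by (metis (mono_tags, lifting) someI_ex)+
  have len: "length xs = n" using xs by (simp add: n_def flip: distinct_card)
  have M: "M \<in> carrier_mat n n" by (simp add: M_def adjacency_matrix_def n_def)
  have bij: "bij_betw ((!) xs) {..<n} (verts G)"
    using bij_betw_nth[OF xs(1), of "{..<n}" "verts G"] len xs(2) by simp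
  have sums: "(\<Sum>b<n. M $$ (a, b) * h (xs ! b)) = (\<Sum>y | y \<in> verts G \<and> {xs ! a, y} \<in> edges G. h y)"
    if "a < n" for a and h :: "'a \<Rightarrow> real"
  proof -
    have "(\<Sum>b<n. M $$ (a, b) * h (xs ! b)) = (\<Sum>b<n. if {xs ! a, xs ! b} \<in> edges G then h (xs ! b) else 0)"
      using that by (intro sum.cong refl) (simp add: M_def adjacency_matrix_def n_def xs_def)
    also have "\<dots> = (\<Sum>y\<in>verts G. if {xs ! a, y} \<in> edges G then h y else 0)"
      by (rule sum.reindex_bij_betw[OF bij, of "\<lambda>y. if {xs ! a, y} \<in> edges G then h y else 0"])
    finally show ?thesis
      using fin by (simp add: sum.inter_filter)
  qed
  have in_verts: "xs ! a \<in> verts G" if "a < n" for a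
    using that len xs(2) by (metis nth_mem)
  obtain i j where ij: "i < n" "j < n" "xs ! i = x" "xs ! j = y"
    using xy(1,2) len xs(2) by (metis in_set_conv_nth)
  have "[:- \<alpha>, 1:] * [:- \<beta>, 1:] dvd char_poly M"
    by (rule two_eigenvectors_dvd_char_poly[OF M ij(1,2), of "\<lambda>a. f (xs ! a)" _ "\<lambda>a. g (xs ! a)"])
      (use sums f g in_verts ij xy(3) in auto)
  then obtain q where q: "char_poly M = [:- \<alpha>, 1:] * [:- \<beta>, 1:] * q" by (elim dvdE)
  have "char_poly M \<noteq> 0" using degree_monic_char_poly[OF M] by auto
  then have "q \<noteq> 0" using q by auto
  have "proots ([:- \<alpha>, 1:] * [:- \<beta>, 1:]) = {#\<alpha>, \<beta>#}"
    by (subst proots_mult) (simp_all add: add_mset_commute)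
  then have "eigenvalue_mset G = {#\<alpha>, \<beta>#} + proots q"
    unfolding eigenvalue_mset_def M_def[symmetric] q
    using \<open>q \<noteq> 0\<close> by (subst proots_mult) simp_all
  then have "{#\<bar>\<alpha>\<bar>, \<bar>\<beta>\<bar>#} \<subseteq># image_mset abs (eigenvalue_mset G)"
    by simp
  then show ?thesis
    unfolding second_abs_eigenvalue_def by (rule second_largest_ge_of_pair)
qed

section \<open>Lipschitz functions on Ramanujan graphs\<close>

lemma ramanujan_verts_nonempty:
  assumes "ramanujan r G"
  shows "verts G \<noteq> {}"
proof
  assume "verts G = {}"
  then have "bipartition G {} {}"
    using assms by (auto simp: ramanujan_def simple_graph_def bipartition_def)
  then show False
    using assms by (auto simp: ramanujan_def bipartite_def)
qed

text \<open>
  Any constant below 1 in place of \<open>1 / 2\<close> would express a spectral gap; \<open>1 / 2\<close> is convenient and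
  holds because \<open>2 sqrt (r - 1) \<le> r / 2\<close> as soon as \<open>16 (r - 1) \<le> r\<^sup>2\<close>. The maximiser of the
  Rayleigh quotient has sum 0 and norm 1, so it is not constant and hence independent of the
  eigenvector of \<open>r\<close>.
\<close>

lemma ramanujan_rayleigh_bound:
  assumes ram: "ramanujan r G" and "r \<ge> 35" and g0: "(\<Sum>x\<in>verts G. g x) = 0"
  shows "(\<Sum>x\<in>verts G. \<Sum>y | y \<in> verts G \<and> {x, y} \<in> edges G. g x * g y)
           \<le> real r / 2 * (\<Sum>x\<in>verts G. (g x)\<^sup>2)"
proof -
  define V where "V = verts G"
  define a :: "'a \<Rightarrow> 'a \<Rightarrow> real" where "a x y = of_bool ({x, y} \<in> edges G)" for x y
  have simple: "simple_graph G" and reg: "regular_graph r G"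
    using ram by (auto simp: ramanujan_def)
  have fin: "finite V" using simple by (simp add: simple_graph_def V_def)
  have a_sum: "(\<Sum>y\<in>V. a x y * h y) = (\<Sum>y | y \<in> V \<and> {x, y} \<in> edges G. h y)" for x and h :: "'a \<Rightarrow> real"
    unfolding a_def using fin by (simp add: sum.inter_filter of_bool_def if_distrib if_distribR cong: if_cong)
  have deg: "card {y \<in> V. {x, y} \<in> edges G} = r" if "x \<in> V" for x
    using reg that by (simp add: regular_graph_def vertex_degree_def V_def)
  have rows: "(\<Sum>y\<in>V. a x y) = real r" if "x \<in> V" for x
    using a_sum[of x "\<lambda>_. 1"] deg[OF that] by simp
  obtain u0 where u0: "u0 \<in> V" using ramanujan_verts_nonempty[OF ram] by (auto simp: V_def)
  have "card {y \<in> V. {u0, y} \<in> edges G} \<noteq> 0" using deg[OF u0] \<open>r \<ge> 35\<close> by simp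
  then have "{y \<in> V. {u0, y} \<in> edges G} \<noteq> {}" by (metis card.empty)
  then obtain v0 where v0: "v0 \<in> V" "{u0, v0} \<in> edges G" by auto
  have "u0 \<noteq> v0"
    using simple v0(2) unfolding simple_graph_def by (metis doubleton_eq_iff)
  have sym: "a x y = a y x" for x y
    by (simp add: a_def insert_commute)
  obtain f \<mu> where f: "(\<Sum>x\<in>V. f x) = 0" "(\<Sum>x\<in>V. (f x)\<^sup>2) = 1"
      "\<And>x. x \<in> V \<Longrightarrow> (\<Sum>y\<in>V. a x y * f y) = \<mu> * f x"
    and max: "\<And>g. (\<Sum>x\<in>V. g x) = 0 \<Longrightarrow>
       (\<Sum>x\<in>V. \<Sum>y\<in>V. a x y * g x * g y) \<le> \<mu> * (\<Sum>x\<in>V. (g x)\<^sup>2)"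
    by (rule rayleigh_maximiser[OF fin u0 v0(1) \<open>u0 \<noteq> v0\<close>, of a "real r"],
        rule sym, erule rows, rule that)
  have "\<exists>x\<in>V. f x \<noteq> f u0"
  proof (rule ccontr)
    assume "\<not> (\<exists>x\<in>V. f x \<noteq> f u0)"
    then have const: "f x = f u0" if "x \<in> V" for x using that by blast
    then have "(\<Sum>x\<in>V. f x) = real (card V) * f u0" by simp
    then have "f u0 = 0" using f(1) fin u0 by auto
    then have "(\<Sum>x\<in>V. (f x)\<^sup>2) = 0" using const by simp
    then show False using f(2) by simp
  qed
  then obtain x where xy: "x \<in> V" "u0 \<in> V" "f x \<noteq> f u0" using u0 by blast
  have "min \<bar>real r\<bar> \<bar>\<mu>\<bar> \<le> second_abs_eigenvalue G"
  proof (rule second_abs_eigenvalue_ge)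
    show "(\<Sum>y | y \<in> verts G \<and> {x, y} \<in> edges G. 1) = real r * 1" if "x \<in> verts G" for x
      using deg that by (simp add: V_def)
    show "(\<Sum>y | y \<in> verts G \<and> {x, y} \<in> edges G. f y) = \<mu> * f x" if "x \<in> verts G" for x
      using f(3)[of x] that unfolding a_sum by (simp add: V_def)
  qed (use fin xy in \<open>auto simp: V_def\<close>)
  also have "\<dots> \<le> 2 * sqrt (real r - 1)"
    using ram by (simp add: ramanujan_def)
  also have "sqrt (real r - 1) \<le> real r / 4"
  proof (rule real_le_lsqrt)
    have "16 * real r \<le> real r * real r" using \<open>r \<ge> 35\<close> by (intro mult_right_mono) auto
    then show "real r - 1 \<le> (real r / 4)\<^sup>2" by (simp add: power2_eq_square)
  qed (use \<open>r \<ge> 35\<close> in auto)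
  finally have "min (real r) \<bar>\<mu>\<bar> \<le> real r / 2" by simp
  then have "\<mu> \<le> real r / 2" using \<open>r \<ge> 35\<close> by (simp add: min_def split: if_splits)
  have "(\<Sum>x\<in>V. \<Sum>y | y \<in> V \<and> {x, y} \<in> edges G. g x * g y) = (\<Sum>x\<in>V. \<Sum>y\<in>V. a x y * g x * g y)"
    unfolding a_sum[symmetric] by (intro sum.cong refl) simp
  also have "\<dots> \<le> \<mu> * (\<Sum>x\<in>V. (g x)\<^sup>2)"
    using max g0 by (simp add: V_def)
  also have "\<dots> \<le> real r / 2 * (\<Sum>x\<in>V. (g x)\<^sup>2)"
    using \<open>\<mu> \<le> real r / 2\<close> by (intro mult_right_mono sum_nonneg) auto
  finally show ?thesis by (simp add: V_def)
qed

text \<open>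
  The Poincare inequality. Let \<open>h\<close> be \<open>g\<close> minus its mean \<open>m\<close>. Summing \<open>(h x - h y)\<^sup>2\<close> over the
  ordered edges gives at most \<open>L\<^sup>2\<close> for each of the \<open>r |V|\<close> terms. Expanding the square, the same
  sum is \<open>2 r \<Sum> h\<^sup>2\<close> minus twice the quadratic form of the adjacency matrix at \<open>h\<close>, hence at
  least \<open>r \<Sum> h\<^sup>2\<close> by the Rayleigh bound.
\<close>

lemma ramanujan_lipschitz_variance:
  assumes ram: "ramanujan r G" and r: "r \<ge> 35"
    and lip: "\<And>x y. \<lbrakk>x \<in> verts G; y \<in> verts G; {x, y} \<in> edges G\<rbrakk> \<Longrightarrow> \<bar>g x - g y\<bar> \<le> L"
  obtains m where "(\<Sum>x\<in>verts G. (g x - m)\<^sup>2) \<le> L\<^sup>2 * real (card (verts G))"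
proof -
  define V where "V = verts G"
  define N where "N x = {y. y \<in> V \<and> {x, y} \<in> edges G}" for x
  define m where "m = (\<Sum>x\<in>V. g x) / real (card V)"
  define h where "h x = g x - m" for x
  have fin: "finite V" and ne: "V \<noteq> {}"
    using ram ramanujan_verts_nonempty[OF ram] by (auto simp: ramanujan_def simple_graph_def V_def)
  have finN: "finite (N x)" for x using fin by (simp add: N_def)
  have deg: "card (N x) = r" if "x \<in> V" for x
    using ram that by (simp add: ramanujan_def regular_graph_def vertex_degree_def V_def N_def)
  have h0: "(\<Sum>x\<in>V. h x) = 0"
    using fin ne by (simp add: h_def m_def sum_subtractf)
  define T where "T = (\<Sum>x\<in>V. (h x)\<^sup>2)"
  have swap: "(\<Sum>x\<in>V. \<Sum>y\<in>N x. F x y) = (\<Sum>x\<in>V. \<Sum>y\<in>N x. F y x)" for F :: "'a \<Rightarrow> 'a \<Rightarrow> real"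
  proof -
    have "(\<Sum>x\<in>V. \<Sum>y\<in>N x. F x y) = (\<Sum>y\<in>V. \<Sum>x | x \<in> V \<and> {x, y} \<in> edges G. F x y)"
      unfolding N_def by (rule sum.swap_restrict[OF fin fin])
    then show ?thesis by (simp add: N_def insert_commute)
  qed
  have sq: "(\<Sum>x\<in>V. \<Sum>y\<in>N x. (h x)\<^sup>2) = real r * T"
    by (simp add: deg T_def sum_distrib_left)
  have "2 * real r * T - 2 * (\<Sum>x\<in>V. \<Sum>y\<in>N x. h x * h y)
      = (\<Sum>x\<in>V. \<Sum>y\<in>N x. (h x)\<^sup>2) + (\<Sum>x\<in>V. \<Sum>y\<in>N x. (h y)\<^sup>2) - (\<Sum>x\<in>V. \<Sum>y\<in>N x. 2 * (h x * h y))"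
    unfolding swap[of "\<lambda>x y. (h y)\<^sup>2"] sq by (simp add: sum_distrib_left)
  also have "\<dots> = (\<Sum>x\<in>V. \<Sum>y\<in>N x. (g x - g y)\<^sup>2)"
    unfolding sum.distrib[symmetric] sum_subtractf[symmetric]
    by (intro sum.cong refl) (simp add: h_def power2_eq_square algebra_simps)
  also have "\<dots> \<le> (\<Sum>x\<in>V. \<Sum>y\<in>N x. L\<^sup>2)"
  proof (intro sum_mono)
    fix x y assume "x \<in> V" "y \<in> N x"
    then have "\<bar>g x - g y\<bar> \<le> L" using lip by (simp add: V_def N_def)
    then show "(g x - g y)\<^sup>2 \<le> L\<^sup>2" by (rule power2_le_iff_abs_le[THEN iffD2, rotated]) (use \<open>\<bar>g x - g y\<bar> \<le> L\<close> in linarith)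
  qed
  also have "\<dots> = real r * (L\<^sup>2 * real (card V))"
    by (simp add: deg)
  finally have "2 * real r * T \<le> real r * (L\<^sup>2 * real (card V)) + 2 * (\<Sum>x\<in>V. \<Sum>y\<in>N x. h x * h y)"
    by simp
  moreover have "(\<Sum>x\<in>V. \<Sum>y\<in>N x. h x * h y) \<le> real r / 2 * T"
    using ramanujan_rayleigh_bound[OF ram r h0[unfolded V_def]] by (simp add: V_def N_def T_def)
  ultimately have "real r * T \<le> real r * (L\<^sup>2 * real (card V))" by simp
  then have "T \<le> L\<^sup>2 * real (card V)" using r by simp
  then show thesis using that[of m] by (simp add: T_def h_def V_def)
qed

text \<open>
  Wherever \<open>m\<close> lies, a fraction \<open>\<epsilon>\<close> of the vertices deviates from it by at least
  \<open>p = (m - a)\<^sup>+\<close> and another fraction \<open>\<epsilon>\<close> by at least \<open>q = (b - m)\<^sup>+\<close>, where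
  \<open>p + q \<ge> b - a\<close>. The variance bound limits \<open>\<epsilon> (p\<^sup>2 + q\<^sup>2)\<close>.
\<close>

lemma ramanujan_lipschitz_levels:
  assumes ram: "ramanujan r G" and r: "r \<ge> 35"
    and lip: "\<And>x y. \<lbrakk>x \<in> verts G; y \<in> verts G; {x, y} \<in> edges G\<rbrakk> \<Longrightarrow> \<bar>g x - g y\<bar> \<le> L"
    and low: "\<epsilon> * real (card (verts G)) \<le> real (card {x \<in> verts G. g x \<le> a})"
    and high: "\<epsilon> * real (card (verts G)) \<le> real (card {x \<in> verts G. b \<le> g x})"
    and "a < b"
  shows "\<epsilon> * (b - a)\<^sup>2 \<le> 2 * L\<^sup>2"
proof -
  define k where "k = real (card (verts G))"
  define X Y where "X = {x \<in> verts G. g x \<le> a}" and "Y = {x \<in> verts G. b \<le> g x}"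
  have fin: "finite (verts G)" using ram by (simp add: ramanujan_def simple_graph_def)
  then have k: "k > 0" using ramanujan_verts_nonempty[OF ram] by (simp add: k_def card_gt_0_iff)
  obtain m where m: "(\<Sum>x\<in>verts G. (g x - m)\<^sup>2) \<le> L\<^sup>2 * k"
    using ramanujan_lipschitz_variance[OF ram r, of g L] lip unfolding k_def by metis
  define p q where "p = max 0 (m - a)" and "q = max 0 (b - m)"
  have XY: "finite X" "finite Y" "X \<inter> Y = {}" "X \<union> Y \<subseteq> verts G"
    using fin \<open>a < b\<close> by (auto simp: X_def Y_def)
  have "(p\<^sup>2 + q\<^sup>2) * (\<epsilon> * k) \<le> real (card X) * p\<^sup>2 + real (card Y) * q\<^sup>2"
    using low high mult_right_mono[of "\<epsilon> * k" "real (card X)" "p\<^sup>2"] mult_right_mono[of "\<epsilon> * k" "real (card Y)" "q\<^sup>2"]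
    by (simp add: X_def Y_def k_def algebra_simps)
  also have "\<dots> = (\<Sum>x\<in>X. p\<^sup>2) + (\<Sum>x\<in>Y. q\<^sup>2)" by simp
  also have "\<dots> \<le> (\<Sum>x\<in>X. (g x - m)\<^sup>2) + (\<Sum>x\<in>Y. (g x - m)\<^sup>2)"
  proof (intro add_mono sum_mono)
    show "p\<^sup>2 \<le> (g x - m)\<^sup>2" if "x \<in> X" for x
      using that by (intro abs_le_square_iff[THEN iffD1]) (auto simp: p_def X_def)
    show "q\<^sup>2 \<le> (g x - m)\<^sup>2" if "x \<in> Y" for x
      using that by (intro abs_le_square_iff[THEN iffD1]) (auto simp: q_def Y_def)
  qed
  also have "\<dots> = (\<Sum>x\<in>X \<union> Y. (g x - m)\<^sup>2)"
    using XY by (simp add: sum.union_disjoint)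
  also have "\<dots> \<le> (\<Sum>x\<in>verts G. (g x - m)\<^sup>2)"
    by (rule sum_mono2) (use XY fin in auto)
  also have "\<dots> \<le> L\<^sup>2 * k" by (rule m)
  finally have "k * ((p\<^sup>2 + q\<^sup>2) * \<epsilon>) \<le> k * L\<^sup>2" by (simp add: algebra_simps)
  then have pq: "(p\<^sup>2 + q\<^sup>2) * \<epsilon> \<le> L\<^sup>2" using k by simp
  have "b - a \<le> p + q" by (auto simp: p_def q_def)
  then have "(b - a)\<^sup>2 \<le> (p + q)\<^sup>2" using \<open>a < b\<close> by (intro power_mono) auto
  also have "\<dots> \<le> 2 * (p\<^sup>2 + q\<^sup>2)"
    using zero_le_power2[of "p - q"] by (simp add: power2_eq_square algebra_simps)
  finally have sq: "(b - a)\<^sup>2 \<le> 2 * (p\<^sup>2 + q\<^sup>2)" .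
  show ?thesis
  proof (cases "\<epsilon> \<ge> 0")
    case True
    then have "\<epsilon> * (b - a)\<^sup>2 \<le> \<epsilon> * (2 * (p\<^sup>2 + q\<^sup>2))" using sq by (intro mult_left_mono) auto
    then show ?thesis using pq by (simp add: algebra_simps)
  next
    case False
    then have "\<epsilon> * (b - a)\<^sup>2 \<le> 0" by (simp add: mult_nonpos_nonneg)
    then show ?thesis using zero_le_power2[of L] by linarith
  qed
qed

section \<open>Layering a spanning subgraph of the chain\<close>

text \<open>
  A condition on single edges, equivalent to being 1-Lipschitz for the graph distance. The values
  are integers rather than naturals so that the difference is a true one.
\<close>

definition unit_lipschitz :: "'a graph \<Rightarrow> ('a \<Rightarrow> int) \<Rightarrow> bool" where
  "unit_lipschitz G l \<longleftrightarrow>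
     (\<forall>u\<in>verts G. \<forall>v\<in>verts G. {u, v} \<in> edges G \<longrightarrow> \<bar>l u - l v\<bar> \<le> 1)"

lemma unit_lipschitzI:
  assumes "\<And>u v. \<lbrakk>u \<in> verts G; v \<in> verts G; {u, v} \<in> edges G\<rbrakk> \<Longrightarrow> \<bar>l u - l v\<bar> \<le> 1"
  shows "unit_lipschitz G l"
  using assms by (simp add: unit_lipschitz_def)

lemma unit_lipschitzD:
  assumes "unit_lipschitz G l" "u \<in> verts G" "v \<in> verts G" "{u, v} \<in> edges G"
  shows "\<bar>l u - l v\<bar> \<le> 1"
  using assms by (simp add: unit_lipschitz_def)

text \<open>
  Equal orders make the embedding onto, so that each level has exactly the size of its class and
  not just at most that size. The level of a vertex is well defined because the classes are
  disjoint; edges inside an end clique join vertices of the same level.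
\<close>

lemma chain_graph_layering:
  fixes A :: "nat \<Rightarrow> 'b set" and H :: "'a graph"
  assumes disj: "disjoint_family_on A {1..100}"
    and fin: "finite (verts (chain_graph A))"
    and sub: "subgraph K (chain_graph A)"
    and iso: "isomorphic H K"
    and card: "card (verts H) = card (verts (chain_graph A))"
  obtains l :: "'a \<Rightarrow> int"
  where "unit_lipschitz H l"
    and "\<And>i. i \<in> {1..100} \<Longrightarrow> card {v \<in> verts H. l v = int i} = card (A i)"
proof -
  obtain h where bij: "bij_betw h (verts H) (verts K)"
    and edge: "\<And>u v. \<lbrakk>u \<in> verts H; v \<in> verts H\<rbrakk> \<Longrightarrow> {u, v} \<in> edges H \<longleftrightarrow> {h u, h v} \<in> edges K"
    using iso unfolding isomorphic_def graph_iso_def by blast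
  have vK: "verts K \<subseteq> verts (chain_graph A)" and eK: "edges K \<subseteq> edges (chain_graph A)"
    using sub by (auto simp: subgraph_def)
  have "card (verts K) = card (verts (chain_graph A))"
    using bij_betw_same_card[OF bij] card by simp
  then have "verts K = verts (chain_graph A)"
    using card_subset_eq[OF fin vK] by simp
  then have bij': "bij_betw h (verts H) (\<Union>i\<in>{1..100}. A i)"
    using bij by (simp add: chain_graph_def)
  define lay where "lay w = (THE i. i \<in> {1..100} \<and> w \<in> A i)" for w
  have lay: "lay w = i" if "i \<in> {1..100}" "w \<in> A i" for w i
    unfolding lay_def
  proof (rule the_equality)
    show "j = i" if "j \<in> {1..100} \<and> w \<in> A j" for j
      using that \<open>i \<in> {1..100}\<close> \<open>w \<in> A i\<close> disj
      by (metis disjoint_family_onD disjoint_iff)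
    show "i \<in> {1..100} \<and> w \<in> A i" using that by blast
  qed
  define l where "l v = int (lay (h v))" for v
  show thesis
  proof (rule that[of l], rule unit_lipschitzI)
    fix u v assume uv: "u \<in> verts H" "v \<in> verts H" "{u, v} \<in> edges H"
    have "{h u, h v} \<in> edges (chain_graph A)"
      using edge uv eK by blast
    then have "(\<exists>p q. {h u, h v} = {p, q} \<and> (\<exists>i\<in>{1..99}. p \<in> A i \<and> q \<in> A (i + 1)))
        \<or> (\<exists>p q. {h u, h v} = {p, q} \<and> p \<in> A 1 \<and> q \<in> A 1)
        \<or> (\<exists>p q. {h u, h v} = {p, q} \<and> p \<in> A 100 \<and> q \<in> A 100)"
      unfolding chain_graph_def by auto
    then consider (step) i p q where "i \<in> {1..99}" "p \<in> A i" "q \<in> A (i + 1)" "{h u, h v} = {p, q}"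
      | (first) "h u \<in> A 1" "h v \<in> A 1"
      | (last) "h u \<in> A 100" "h v \<in> A 100"
      unfolding doubleton_eq_iff by blast
    then show "\<bar>l u - l v\<bar> \<le> 1"
    proof cases
      case step
      then have "lay p = i" "lay q = i + 1" by (auto intro!: lay)
      with step show ?thesis by (auto simp: l_def doubleton_eq_iff)
    qed (use lay[of 1] lay[of 100] in \<open>simp_all add: l_def\<close>)
  next
    fix i :: nat assume i: "i \<in> {1..100}"
    have img: "h ` verts H = (\<Union>i\<in>{1..100}. A i)" and inj: "inj_on h (verts H)"
      using bij' by (auto simp: bij_betw_def)
    have mem: "h v \<in> A (lay (h v))" if v: "v \<in> verts H" for v
    proof -
      have "h v \<in> (\<Union>i\<in>{1..100}. A i)" using v img by blast
      then obtain j where "j \<in> {1..100}" "h v \<in> A j" by blast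
      then show ?thesis using lay by simp
    qed
    have "h ` {v \<in> verts H. l v = int i} = A i"
    proof
      show "h ` {v \<in> verts H. l v = int i} \<subseteq> A i"
        using mem by (auto simp: l_def)
      show "A i \<subseteq> h ` {v \<in> verts H. l v = int i}"
      proof
        fix w assume "w \<in> A i"
        then obtain v where "v \<in> verts H" "w = h v" using img i by blast
        then show "w \<in> h ` {v \<in> verts H. l v = int i}"
          using \<open>w \<in> A i\<close> lay[OF i] by (auto simp: l_def)
      qed
    qed
    then show "card {v \<in> verts H. l v = int i} = card (A i)"
      using card_image[OF inj_on_subset[OF inj, of "{v \<in> verts H. l v = int i}"]] by simp
  qed
qed

section \<open>Brooms and their owners\<close>

text \<open>
  Along the path the value changes by at most 1 per step, and a leaf is one step beyond the last
  path vertex \<open>t - 1\<close>.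
\<close>

lemma broom_depth:
  fixes \<phi> :: "nat \<Rightarrow> int"
  assumes lip: "unit_lipschitz (broom t d) \<phi>"
    and "t \<ge> 1" and "j < t + d"
  shows "\<bar>\<phi> j - \<phi> 0\<bar> \<le> int t"
proof -
  have path: "\<bar>\<phi> j - \<phi> 0\<bar> \<le> int j" if "j < t" for j
    using that
  proof (induction j)
    case (Suc j)
    have "{j, Suc j} \<in> edges (broom t d)"
      using Suc.prems by (auto simp: broom_def)
    then have "\<bar>\<phi> j - \<phi> (Suc j)\<bar> \<le> 1" using Suc.prems by (intro unit_lipschitzD[OF lip]) (auto simp: broom_def)
    then show ?case using Suc by simp
  qed simp
  show ?thesis
  proof (cases "j < t")
    case True
    then show ?thesis using path[OF True] by simp
  next
    case False
    then have "{t - 1, j} \<in> edges (broom t d)"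
      using \<open>j < t + d\<close> by (auto simp: broom_def)
    then have "\<bar>\<phi> (t - 1) - \<phi> j\<bar> \<le> 1" using \<open>t \<ge> 1\<close> \<open>j < t + d\<close>
      by (intro unit_lipschitzD[OF lip]) (auto simp: broom_def)
    moreover have "\<bar>\<phi> (t - 1) - \<phi> 0\<bar> \<le> int (t - 1)" using \<open>t \<ge> 1\<close> by (intro path) simp
    ultimately show ?thesis using \<open>t \<ge> 1\<close> by simp
  qed
qed

lemma Union_graph_components:
  "(\<Union>K\<in>graph_components G. verts K) = verts G"
  by (auto simp: graph_components_def induced_def)

lemma edges_graph_components:
  "K \<in> graph_components G \<Longrightarrow> edges K \<subseteq> edges G"
  by (auto simp: graph_components_def induced_def)

lemma graph_components_eqI:
  assumes KL: "K \<in> graph_components G" "L \<in> graph_components G"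
    and w: "w \<in> verts K" "w \<in> verts L"
  shows "K = L"
proof -
  define E where "E = (\<lambda>x y. {x, y} \<in> edges G)"
  have "symp E" by (auto simp: E_def symp_def insert_commute)
  then have sym: "E\<^sup>*\<^sup>* x y \<Longrightarrow> E\<^sup>*\<^sup>* y x" for x y
    by (metis symp_rtranclp sympD)
  obtain a b where a: "K = induced G {w \<in> verts G. E\<^sup>*\<^sup>* a w}" and b: "L = induced G {w \<in> verts G. E\<^sup>*\<^sup>* b w}"
    using KL by (auto simp: graph_components_def E_def)
  have "E\<^sup>*\<^sup>* a w" "E\<^sup>*\<^sup>* b w"
    using w by (auto simp: a b induced_def)
  then have "E\<^sup>*\<^sup>* a x \<longleftrightarrow> E\<^sup>*\<^sup>* b x" for x
    using sym by (meson rtranclp_trans)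
  then show ?thesis by (simp add: a b)
qed

text \<open>
  The owner \<open>\<rho> v\<close> of a vertex is the vertex itself if it lies in \<open>S\<close>, and otherwise the unique
  neighbour in \<open>S\<close> of the first vertex of its component. A vertex of \<open>S\<close> has a single neighbour
  outside \<open>S\<close>, so it owns at most one component; as there are as many components as vertices in
  \<open>S\<close>, the bound on the fibres of \<open>\<rho>\<close> matches the total number of vertices.
\<close>

lemma broom_ownership:
  fixes H :: "'a graph" and S :: "'a set" and lab :: "'a graph \<Rightarrow> nat \<Rightarrow> 'a"
  defines "comps \<equiv> graph_components (induced H (verts H - S))"
  defines "firsts \<equiv> (\<lambda>K. lab K 0) ` comps"
  assumes fin: "finite (verts H)" and S: "S \<subseteq> verts H" and "t \<ge> 1"
    and cards: "card comps = card S"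
    and lab: "\<And>K. K \<in> comps \<Longrightarrow> graph_iso (lab K) (broom t d) K"
    and out: "\<And>x. x \<in> S \<Longrightarrow> \<exists>!y. y \<in> verts H - S \<and> {x, y} \<in> edges H"
    and inward: "\<And>y. y \<in> firsts \<Longrightarrow> \<exists>!x. x \<in> S \<and> {x, y} \<in> edges H"
  obtains \<rho> where "\<And>v. v \<in> verts H \<Longrightarrow> \<rho> v \<in> S"
    and "\<And>x. x \<in> S \<Longrightarrow> card {v \<in> verts H. \<rho> v = x} \<le> 1 + t + d"
    and "card (verts H) = card S * (1 + t + d)"
    and "\<And>(l :: 'a \<Rightarrow> int) v. \<lbrakk>unit_lipschitz H l; v \<in> verts H\<rbrakk> \<Longrightarrow> \<bar>l v - l (\<rho> v)\<bar> \<le> 1 + int t"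
proof -
  define R where "R = verts H - S"
  have finR: "finite R" using fin by (simp add: R_def)
  have UnR: "(\<Union>K\<in>comps. verts K) = R"
    unfolding comps_def Union_graph_components by (simp add: induced_def R_def)
  have edgesK: "edges K \<subseteq> edges H" if "K \<in> comps" for K
    using edges_graph_components that unfolding comps_def by (fastforce simp: induced_def)
  have eqI: "K = L" if "K \<in> comps" "L \<in> comps" "w \<in> verts K" "w \<in> verts L" for K L w
    using graph_components_eqI that unfolding comps_def by metis
  have bij: "bij_betw (lab K) {0..<t + d} (verts K)" if "K \<in> comps" for K
    using lab[OF that] by (simp add: graph_iso_def broom_def)
  have cardK: "card (verts K) = t + d" if "K \<in> comps" for K
    using bij_betw_same_card[OF bij[OF that]] by simp
  have finK: "finite (verts K)" if "K \<in> comps" for K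
    using bij_betw_finite[OF bij[OF that]] by simp
  have fincomps: "finite comps"
    unfolding comps_def graph_components_def using finR by (simp add: induced_def R_def)
  have "card R = (\<Sum>K\<in>comps. card (verts K))"
    unfolding UnR[symmetric] using fincomps finK eqI by (intro card_UN_disjoint) auto
  also have "\<dots> = card S * (t + d)" by (simp add: cardK cards)
  finally have cardR: "card R = card S * (t + d)" .
  have cardH: "card (verts H) = card S * (1 + t + d)"
  proof -
    have "card (verts H) = card S + card R"
      using card_Diff_subset[OF finite_subset[OF S fin] S] card_mono[OF fin S] by (simp add: R_def)
    then show ?thesis by (simp add: cardR)
  qed
  define comp_of where "comp_of v = (THE K. K \<in> comps \<and> v \<in> verts K)" for v
  have comp_of_eq: "comp_of v = K" if "K \<in> comps" "v \<in> verts K" for K v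
    unfolding comp_of_def using that eqI by (intro the_equality) auto
  have comp_of: "comp_of v \<in> comps" "v \<in> verts (comp_of v)" if "v \<in> R" for v
    using that UnR comp_of_eq by auto
  define first_of where "first_of v = lab (comp_of v) 0" for v
  have first_of: "first_of v \<in> verts (comp_of v)" "first_of v \<in> R" "first_of v \<in> firsts" if "v \<in> R" for v
  proof -
    show "first_of v \<in> verts (comp_of v)"
      using bij_betwE[OF bij[OF comp_of(1)[OF that]]] \<open>t \<ge> 1\<close> by (auto simp: first_of_def)
    then show "first_of v \<in> R" using UnR comp_of(1)[OF that] by blast
    show "first_of v \<in> firsts" using comp_of(1)[OF that] by (simp add: firsts_def first_of_def)
  qed
  define \<rho> where "\<rho> v = (if v \<in> S then v else THE x. x \<in> S \<and> {x, first_of v} \<in> edges H)" for v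
  have \<rho>R: "\<rho> v \<in> S \<and> {\<rho> v, first_of v} \<in> edges H" if "v \<in> R" for v
    using theI'[OF inward[OF first_of(3)[OF that]]] that by (simp add: \<rho>_def R_def)
  show thesis
  proof (rule that[of \<rho>])
    show "\<rho> v \<in> S" if "v \<in> verts H" for v
      using \<rho>R[of v] that by (cases "v \<in> S") (auto simp: \<rho>_def R_def)
  next
    fix x assume x: "x \<in> S"
    (* If v lies outside S and is owned by x, then first_of v is the only neighbour z of x outside S, so v
       belongs to the component of z. *)
    obtain z where z: "z \<in> R" and uniq: "\<And>z'. z' \<in> R \<Longrightarrow> {x, z'} \<in> edges H \<Longrightarrow> z' = z"
      using out[OF x] by (auto simp: R_def)
    have "{v \<in> verts H. \<rho> v = x} \<subseteq> insert x (verts (comp_of z))"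
    proof
      fix v assume v: "v \<in> {v \<in> verts H. \<rho> v = x}"
      show "v \<in> insert x (verts (comp_of z))"
      proof (cases "v \<in> S")
        case True
        then show ?thesis using v by (simp add: \<rho>_def)
      next
        case False
        then have vR: "v \<in> R" using v by (simp add: R_def)
        then have "first_of v = z" using uniq first_of(2) \<rho>R v by auto
        then have "comp_of z = comp_of v" using first_of(1)[OF vR] comp_of(1)[OF vR] comp_of_eq by simp
        then show ?thesis using comp_of(2)[OF vR] by simp
      qed
    qed
    then have "card {v \<in> verts H. \<rho> v = x} \<le> card (insert x (verts (comp_of z)))"
      using finK[OF comp_of(1)[OF z]] by (intro card_mono) auto
    also have "\<dots> \<le> 1 + t + d"
      using cardK[OF comp_of(1)[OF z]] finK[OF comp_of(1)[OF z]] by (simp add: card_insert_if)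
    finally show "card {v \<in> verts H. \<rho> v = x} \<le> 1 + t + d" .
  next
    show "card (verts H) = card S * (1 + t + d)" by (rule cardH)
  next
    fix l :: "'a \<Rightarrow> int" and v
    assume lip: "unit_lipschitz H l"
      and v: "v \<in> verts H"
    show "\<bar>l v - l (\<rho> v)\<bar> \<le> 1 + int t"
    proof (cases "v \<in> S")
      case True
      then show ?thesis by (simp add: \<rho>_def)
    next
      case False
      then have vR: "v \<in> R" using v by (simp add: R_def)
      let ?K = "comp_of v"
      have K: "?K \<in> comps" "v \<in> verts ?K" using comp_of[OF vR] by auto
      have KR: "verts ?K \<subseteq> verts H" using UnR K(1) by (auto simp: R_def)
      obtain j where j: "j < t + d" "lab ?K j = v"
        using bij_betw_imp_surj_on[OF bij[OF K(1)]] K(2) by force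
      have labK: "lab ?K a \<in> verts ?K" if "a < t + d" for a
        using bij_betwE[OF bij[OF K(1)]] that by auto
      have "\<bar>l (lab ?K j) - l (lab ?K 0)\<bar> \<le> int t"
      proof (rule broom_depth[where \<phi> = "\<lambda>a. l (lab ?K a)"], rule unit_lipschitzI)
        fix a b assume "a \<in> verts (broom t d)" "b \<in> verts (broom t d)"
          and edge: "{a, b} \<in> edges (broom t d)"
        then have ab: "a < t + d" "b < t + d" by (simp_all add: broom_def)
        with edge have "{lab ?K a, lab ?K b} \<in> edges ?K"
          using lab[OF K(1)] by (simp add: graph_iso_def broom_def)
        then show "\<bar>l (lab ?K a) - l (lab ?K b)\<bar> \<le> 1"
          using edgesK[OF K(1)] KR labK ab by (intro unit_lipschitzD[OF lip]) auto
      qed (use j \<open>t \<ge> 1\<close> in auto)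
      moreover have "\<bar>l (\<rho> v) - l (first_of v)\<bar> \<le> 1"
        using \<rho>R[OF vR] S first_of(1)[OF vR] KR by (intro unit_lipschitzD[OF lip]) auto
      ultimately show ?thesis by (simp add: j(2) first_of_def)
    qed
  qed
qed

section \<open>The expander cannot be stretched along the chain\<close>

lemma card_le_mult_fibres:
  assumes "finite X" "\<rho> ` W \<subseteq> X" "W \<subseteq> V"
    and "\<And>x. x \<in> X \<Longrightarrow> card {v \<in> V. \<rho> v = x} \<le> N" and "finite V"
  shows "card W \<le> card X * N"
proof -
  have "card W \<le> card (\<Union>x\<in>X. {v \<in> V. \<rho> v = x})"
    using assms by (intro card_mono) auto
  also have "\<dots> \<le> (\<Sum>x\<in>X. card {v \<in> V. \<rho> v = x})"
    by (rule card_UN_le[OF \<open>finite X\<close>])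
  also have "\<dots> \<le> (\<Sum>x\<in>X. N)"
    using assms(4) by (rule sum_mono)
  finally show ?thesis by simp
qed

text \<open>
  Passing from the vertices of the double cover to those of the base graph loses at most a factor
  of 2, because each base vertex has two copies.
\<close>

lemma double_cover_projection:
  fixes f :: "'u + 'u \<Rightarrow> 'a" and P :: "'a \<Rightarrow> bool" and Q :: "'u \<Rightarrow> bool"
  assumes fin: "finite V"
    and PQ: "\<And>x. \<lbrakk>x \<in> V; P (f (Inl x)) \<or> P (f (Inr x))\<rbrakk> \<Longrightarrow> Q x"
  shows "card {s \<in> f ` Inl ` V \<union> f ` Inr ` V. P s} \<le> 2 * card {x \<in> V. Q x}"
proof -
  let ?W = "{x \<in> V. Q x}"
  have "card {s \<in> f ` Inl ` V \<union> f ` Inr ` V. P s} \<le> card ((\<lambda>x. f (Inl x)) ` ?W \<union> (\<lambda>x. f (Inr x)) ` ?W)"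
    using fin PQ by (intro card_mono) auto
  also have "\<dots> \<le> card ((\<lambda>x. f (Inl x)) ` ?W) + card ((\<lambda>x. f (Inr x)) ` ?W)"
    by (rule card_Un_le)
  also have "\<dots> \<le> card ?W + card ?W"
    using fin by (intro add_mono card_image_le) auto
  finally show ?thesis by simp
qed

theorem lemma11:
  fixes C :: real
    and r t n :: nat
    and U :: "nat \<Rightarrow> 'u graph"
    and H :: "'a graph"
    and G :: "'b graph"
    and A :: "nat \<Rightarrow> 'b set"
  assumes "C > 0"
    and "r \<ge> 35" and "t \<ge> 1"
    and "ramanujan_sequence r U"
    and "H \<in> H_class C U r t n"
    and "simple_graph G" and "card (verts G) = n"
    and "disjoint_family_on A {1..100}"
    and "\<forall>i\<in>{1..100}. real (card (A i)) = real n / 100"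
    and "G = chain_graph A"
    and "t \<le> 13"
  shows "\<not> (\<exists>K. subgraph K G \<and> isomorphic H K)"
proof
  assume "\<exists>K. subgraph K G \<and> isomorphic H K"
  then obtain K where K: "subgraph K (chain_graph A)" "isomorphic H K"
    using \<open>G = chain_graph A\<close> by blast
  define d where "d = max_degree H - 1"
  have simpleH: "simple_graph H" and cardH: "card (verts H) = n"
    using \<open>H \<in> H_class C U r t n\<close> by (auto simp: H_class_def)
  have finH: "finite (verts H)" using simpleH by (simp add: simple_graph_def)
  obtain i S SA SB lab f where
    S: "S \<subseteq> verts H" "S = SA \<union> SB" "SA \<inter> SB = {}"
       "card SA = card (verts (U i))" "card SB = card (verts (U i))"
    and iso: "graph_iso f (double_cover_plus (U i)) (induced_between H SA SB)"
    and f: "f ` Inl ` verts (U i) = SA" "f ` Inr ` verts (U i) = SB"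
    and comps: "card (graph_components (induced H (verts H - S))) = card S"
       "\<And>K. K \<in> graph_components (induced H (verts H - S)) \<Longrightarrow> graph_iso (lab K) (broom t d) K"
       "\<And>x. x \<in> S \<Longrightarrow> \<exists>!y. y \<in> verts H - S \<and> {x, y} \<in> edges H"
       "\<And>y. y \<in> (\<lambda>K. lab K 0) ` graph_components (induced H (verts H - S)) \<Longrightarrow>
          \<exists>!x. x \<in> S \<and> {x, y} \<in> edges H"
    using \<open>H \<in> H_class C U r t n\<close>
    unfolding H_class_def mem_Collect_eq Let_def d_def[symmetric]
    by (elim exE conjE) (rule that, (assumption | erule (1) bspec)+)
  define k where "k = card (verts (U i))"
  define N where "N = 1 + t + d"
  have ram: "ramanujan r (U i)" using \<open>ramanujan_sequence r U\<close> by (simp add: ramanujan_sequence_def)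
  have finU: "finite (verts (U i))" using ram by (simp add: ramanujan_def simple_graph_def)
  have finS: "finite S" using S(1) finH by (rule finite_subset)
  have cardS: "card S = 2 * k"
    using S finS by (simp add: card_Un_disjoint k_def)
  obtain l :: "'a \<Rightarrow> int" where
    lip: "unit_lipschitz H l"
    and level: "\<And>i. i \<in> {1..100} \<Longrightarrow> card {v \<in> verts H. l v = int i} = card (A i)"
    by (rule chain_graph_layering[OF assms(8) _ K])
      (use assms(6,7,10) cardH in \<open>auto simp: simple_graph_def\<close>)
  obtain \<rho> where \<rho>S: "\<And>v. v \<in> verts H \<Longrightarrow> \<rho> v \<in> S"
    and fibre: "\<And>x. x \<in> S \<Longrightarrow> card {v \<in> verts H. \<rho> v = x} \<le> 1 + t + d"
    and total: "card (verts H) = card S * (1 + t + d)"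
    and near: "\<And>(l :: 'a \<Rightarrow> int) v. \<lbrakk>unit_lipschitz H l; v \<in> verts H\<rbrakk> \<Longrightarrow> \<bar>l v - l (\<rho> v)\<bar> \<le> 1 + int t"
    by (rule broom_ownership[OF finH S(1) \<open>t \<ge> 1\<close> comps(1), where lab = lab and d = d],
        erule comps(2), erule comps(3), erule comps(4), rule that; blast)
  have near14: "\<bar>l v - l (\<rho> v)\<bar> \<le> 14" if "v \<in> verts H" for v
    using near[of l, OF lip that] \<open>t \<le> 13\<close> by simp
  (* k / 50 is one percent of |S| = 2 k. The owners of the vertices on level i lie within 14 levels
     of i, and each of them owns at most N of these n / 100 = |S| N / 100 vertices. *)
  have many: "real (card {x \<in> S. P (l x)}) \<ge> real k / 50"
    if i: "i \<in> {1..100}" and P: "\<And>j. \<bar>int i - j\<bar> \<le> 14 \<Longrightarrow> P j" for i and P :: "int \<Rightarrow> bool"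
  proof -
    have "P (l (\<rho> v))" if "v \<in> verts H" "l v = int i" for v
      using near14[OF that(1)] that(2) by (intro P) simp
    then have "\<rho> ` {v \<in> verts H. l v = int i} \<subseteq> {x \<in> S. P (l x)}"
      using \<rho>S by blast
    then have "card {v \<in> verts H. l v = int i} \<le> card {x \<in> S. P (l x)} * N"
      using finS finH fibre by (intro card_le_mult_fibres[where \<rho> = \<rho> and V = "verts H"]) (auto simp: N_def)
    then have "real (card {v \<in> verts H. l v = int i}) \<le> real (card {x \<in> S. P (l x)}) * real N"
      unfolding of_nat_mult[symmetric] of_nat_le_iff .
    moreover have "real (card {v \<in> verts H. l v = int i}) = real n / 100"
      using level[OF i] assms(9) i by simp
    ultimately have "real n / 100 \<le> real (card {x \<in> S. P (l x)}) * real N"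
      by simp
    moreover have "real n = 2 * real k * real N"
      using total by (simp add: cardH cardS N_def algebra_simps)
    ultimately have "real N * (real k / 50) \<le> real N * real (card {x \<in> S. P (l x)})"
      by (simp add: algebra_simps)
    then show ?thesis by (simp add: N_def)
  qed
  have fS: "f (Inl x) \<in> verts H" "f (Inr x) \<in> verts H" if "x \<in> verts (U i)" for x
    using f S(1,2) that by auto
  have iso_edge: "{f p, f q} \<in> edges H"
    if "p \<in> verts (U i) <+> verts (U i)" "q \<in> verts (U i) <+> verts (U i)"
      "{p, q} \<in> edges (double_cover_plus (U i))" for p q
    using iso that by (auto simp: graph_iso_def double_cover_plus_def induced_between_def)
  (* The edges x_1 x_2 and x_1 y_2 of the double cover. Joining them gives walks of length 2 between
     the first copies x_1 and y_1 of adjacent x and y. *)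
  have rung: "\<bar>l (f (Inl x)) - l (f (Inr x))\<bar> \<le> 1" if "x \<in> verts (U i)" for x
    using that by (intro unit_lipschitzD[OF lip] fS iso_edge) (auto simp: double_cover_plus_def)
  have cross: "\<bar>l (f (Inl x)) - l (f (Inr y))\<bar> \<le> 1"
    if "x \<in> verts (U i)" "y \<in> verts (U i)" "{x, y} \<in> edges (U i)" for x y
    using that by (intro unit_lipschitzD[OF lip] fS iso_edge) (auto simp: double_cover_plus_def)
  define g where "g x = real_of_int (l (f (Inl x)))" for x
  have S_eq: "S = f ` Inl ` verts (U i) \<union> f ` Inr ` verts (U i)" using S(2) f by simp
  (* The levels 15 = 1 + 14 and 86 = 100 - 14 each move by 1 when second copies are replaced by
     first copies. *)
  have "(1 / 100) * (85 - 16)\<^sup>2 \<le> 2 * (2::real)\<^sup>2"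
  proof (rule ramanujan_lipschitz_levels[OF ram \<open>r \<ge> 35\<close>, of g])
    show "\<bar>g x - g y\<bar> \<le> 2" if "x \<in> verts (U i)" "y \<in> verts (U i)" "{x, y} \<in> edges (U i)" for x y
      using cross[OF that] rung[OF that(2)] unfolding g_def by linarith
    have low: "real k / 50 \<le> real (card {x \<in> S. l x \<le> 15})"
      by (rule many[of 1]) auto
    have "card {s \<in> S. l s \<le> 15} \<le> 2 * card {x \<in> verts (U i). g x \<le> 16}"
      unfolding S_eq
    proof (rule double_cover_projection[OF finU])
      fix x assume "x \<in> verts (U i)" "l (f (Inl x)) \<le> 15 \<or> l (f (Inr x)) \<le> 15"
      then show "g x \<le> 16" using rung[of x] unfolding g_def by linarith
    qed
    then show "1 / 100 * real (card (verts (U i))) \<le> real (card {x \<in> verts (U i). g x \<le> 16})"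
      using low by (simp add: k_def)
    have high: "real k / 50 \<le> real (card {x \<in> S. 86 \<le> l x})"
      by (rule many[of 100]) auto
    have "card {s \<in> S. l s \<ge> 86} \<le> 2 * card {x \<in> verts (U i). 85 \<le> g x}"
      unfolding S_eq
    proof (rule double_cover_projection[OF finU])
      fix x assume "x \<in> verts (U i)" "86 \<le> l (f (Inl x)) \<or> 86 \<le> l (f (Inr x))"
      then show "85 \<le> g x" using rung[of x] unfolding g_def by linarith
    qed
    then show "1 / 100 * real (card (verts (U i))) \<le> real (card {x \<in> verts (U i). 85 \<le> g x})"
      using high by (simp add: k_def)
  qed simp
  then show False by simp
qed

end
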